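(* Let $\mathcal E$ be an ellipsoid in $\mathbb R^3$ with semiaxes $s_1,s_2,s_3$ contained inside a sphere $\mathcal B$ of radius $R$. Let $\mathbf d$ be the vector from the centre of $\mathcal B$ to the centre of $\mathcal E$, let $d=|\mathbf d|$ be the distance between the centres, and suppose that $\mathcal E$ has its $s_1$ axis collinear with $\mathbf d$. The sole necessary and sufficient condition for the existence of a tetrahedron circumscribed about $\mathcal E$ and inscribed in $\mathcal B$ is $$d^2\le (R-s_1)^2-(s_2+s_3)^2.$$
   Context: Here $s_1,s_2,s_3$ are the lengths of the semiaxes of $\mathcal E$, and the $s_1$ axis is the axis along which the semiaxis has length $s_1$. The ellipsoid may be degenerate (some $s_i=0$). "Contained inside $\mathcal B$" means contained in the closed ball bounded by $\mathcal B$. The terms "circumscribed about" and "inscribed in" are used in their usual sense in Euclidean geometry.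
   Formalization: If the ellipsoid is a single point (all semiaxes zero), "circumscribed about" is read as "containing", since no point lies on all four faces of a tetrahedron and the claim would otherwise fail; in all other cases every face must touch the ellipsoid. *)

theory Defs
  imports "HOL-Analysis.Analysis"
begin

definition orthonormal_frame :: "real^3 \<Rightarrow> real^3 \<Rightarrow> real^3 \<Rightarrow> bool" where
  "orthonormal_frame u1 u2 u3 \<longleftrightarrow>
     norm u1 = 1 \<and> norm u2 = 1 \<and> norm u3 = 1 \<and>
     orthogonal u1 u2 \<and> orthogonal u1 u3 \<and> orthogonal u2 u3"

text \<open>
  The solid ellipsoid with centre \<open>c\<close> whose semiaxes have lengths \<open>s1\<close>, \<open>s2\<close>, \<open>s3\<close> and directions
  \<open>u1\<close>, \<open>u2\<close>, \<open>u3\<close>. Zero lengths are allowed and give an elliptical disc, a line segment or a point.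
\<close>
definition ellipsoid ::
  "real^3 \<Rightarrow> real^3 \<Rightarrow> real^3 \<Rightarrow> real^3 \<Rightarrow> real \<Rightarrow> real \<Rightarrow> real \<Rightarrow> (real^3) set" where
  "ellipsoid c u1 u2 u3 s1 s2 s3 =
     {c + (s1 * x) *\<^sub>R u1 + (s2 * y) *\<^sub>R u2 + (s3 * z) *\<^sub>R u3 | x y z. x\<^sup>2 + y\<^sup>2 + z\<^sup>2 \<le> 1}"

text \<open>A tetrahedron is the convex hull of four affinely independent points, so it is never flat.\<close>
definition tetrahedron :: "(real^3) set \<Rightarrow> bool" where
  "tetrahedron T \<longleftrightarrow> 3 simplex T"

definition inscribed_in :: "(real^3) set \<Rightarrow> (real^3) set \<Rightarrow> bool" where
  "inscribed_in T S \<longleftrightarrow> (\<forall>v. v extreme_point_of T \<longrightarrow> v \<in> S)"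

text \<open>
  Since \<open>T\<close> contains \<open>E\<close>, a face that meets \<open>E\<close> lies in a supporting plane of \<open>E\<close>, which for an
  ellipsoid with nonempty interior is a tangent plane. No point lies on all four faces of a
  tetrahedron, so for a one-point \<open>E\<close> tangency is meaningless and only containment is required.
\<close>
definition circumscribed_about :: "(real^3) set \<Rightarrow> (real^3) set \<Rightarrow> bool" where
  "circumscribed_about T E \<longleftrightarrow>
     E \<subseteq> T \<and> (is_singleton E \<or> (\<forall>F. F facet_of T \<longrightarrow> F \<inter> E \<noteq> {}))"

end

theory Submission
  imports Defs
begin

text \<open>
  Let \<open>R = 1\<close>. If a tetrahedron with vertices \<open>v\<close> contains the ellipsoid, the barycentric coordinates of the
  ellipsoid point with parameter \<open>t\<close> are \<open>p + w \<bullet> t\<close> with \<open>p \<ge> norm w\<close>, so \<open>(1, v)\<close> and \<open>(p, w)\<close> lie in the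
  forward light cone of Minkowski space, and the sum of the tensors \<open>(1, v) \<otimes> (p, w)\<close> is the \<open>4 \<times> 4\<close> matrix of
  the affine parametrisation of the ellipsoid. The light-cone condition gives
  \<open>(v2 w2 + v3 w3)\<^sup>2 \<le> (1 + v1) (p - w1) \<cdot> (1 - v1) (p + w1)\<close> for each vertex, and summing with the
  Cauchy-Schwarz inequality gives \<open>(s2 + s3)\<^sup>2 \<le> (1 + \<delta> - s1) (1 - \<delta> - s1)\<close>, where \<open>\<delta> = \<plusminus>d\<close>.

  Conversely one needs such a decomposition with light-like \<open>(1, v)\<close> and \<open>(p, w)\<close>. Lorentz boosts along the
  first axis on both factors move the centre of the ellipsoid to the centre of the sphere and turn the
  condition into \<open>t1 + t2 + t3 \<le> 1\<close> for the new semiaxes, where explicit tetrahedra exist. Segments,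
  whose boost may degenerate, are treated directly.
\<close>

subsection \<open>Light-like decompositions\<close>

text \<open>
  In coordinates along the axes with \<open>R = 1\<close> and \<open>b = 0\<close>: the vertices are \<open>v i = (x i, y i, z i)\<close>, and
  \<open>p i + (f i, g i, h i) \<bullet> t\<close> is the \<open>i\<close>-th barycentric coordinate of the point of the ellipsoid with
  parameter \<open>t\<close> in the unit ball. It vanishes at exactly one point of that ball when
  \<open>p i = norm (f i, g i, h i) > 0\<close>, which is tangency to the \<open>i\<close>-th face; \<open>p i = 0\<close> puts the whole
  (degenerate) ellipsoid in that face.
\<close>
definition tangent_data ::
  "real \<Rightarrow> real \<Rightarrow> real \<Rightarrow> real \<Rightarrow> (nat \<Rightarrow> real) \<Rightarrow> (nat \<Rightarrow> real) \<Rightarrow> (nat \<Rightarrow> real) \<Rightarrow>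
   (nat \<Rightarrow> real) \<Rightarrow> (nat \<Rightarrow> real) \<Rightarrow> (nat \<Rightarrow> real) \<Rightarrow> (nat \<Rightarrow> real) \<Rightarrow> bool" where
  "tangent_data \<delta> s1 s2 s3 x y z p f g h \<longleftrightarrow>
     (\<forall>i<4. (x i)\<^sup>2 + (y i)\<^sup>2 + (z i)\<^sup>2 = 1 \<and> 0 \<le> p i \<and> (p i)\<^sup>2 = (f i)\<^sup>2 + (g i)\<^sup>2 + (h i)\<^sup>2) \<and>
     (\<forall>\<mu>. (\<Sum>i<4. \<mu> i) = 0 \<and> (\<Sum>i<4. x i * \<mu> i) = 0 \<and> (\<Sum>i<4. y i * \<mu> i) = 0 \<and>
           (\<Sum>i<4. z i * \<mu> i) = 0 \<longrightarrow> (\<forall>i<4. \<mu> i = 0)) \<and>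
     (\<Sum>i<4. p i) = 1 \<and> (\<Sum>i<4. f i) = 0 \<and> (\<Sum>i<4. g i) = 0 \<and> (\<Sum>i<4. h i) = 0 \<and>
     (\<Sum>i<4. x i * p i) = \<delta> \<and> (\<Sum>i<4. x i * f i) = s1 \<and>
     (\<Sum>i<4. x i * g i) = 0 \<and> (\<Sum>i<4. x i * h i) = 0 \<and>
     (\<Sum>i<4. y i * p i) = 0 \<and> (\<Sum>i<4. y i * f i) = 0 \<and>
     (\<Sum>i<4. y i * g i) = s2 \<and> (\<Sum>i<4. y i * h i) = 0 \<and>
     (\<Sum>i<4. z i * p i) = 0 \<and> (\<Sum>i<4. z i * f i) = 0 \<and>
     (\<Sum>i<4. z i * g i) = 0 \<and> (\<Sum>i<4. z i * h i) = s3"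

abbreviation quad :: "real \<Rightarrow> real \<Rightarrow> real \<Rightarrow> real \<Rightarrow> nat \<Rightarrow> real" where
  "quad a b c d \<equiv> (\<lambda>i. [a, b, c, d] ! i)"

lemma all_less_4: "(\<forall>i<4::nat. P i) \<longleftrightarrow> P 0 \<and> P 1 \<and> P 2 \<and> P 3"
  by (auto simp: numeral_eq_Suc less_Suc_eq)

lemma sum_less_4: "(\<Sum>i<4::nat. F i) = F 0 + F 1 + F 2 + (F 3 :: real)"
  by (simp add: numeral_eq_Suc)

lemma tangent_data_swap:
  assumes "tangent_data \<delta> s1 s2 s3 x y z p f g h"
  shows "tangent_data \<delta> s1 s3 s2 x z y p f h g"
  using assms unfolding tangent_data_def by (simp add: add.assoc add.commute add.left_commute)

lemma sum_bilinear:
  fixes x p f :: "nat \<Rightarrow> real"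
  shows "(\<Sum>i\<in>I. (a + b * x i) * (c * p i + e * f i)) =
    a * c * (\<Sum>i\<in>I. p i) + a * e * (\<Sum>i\<in>I. f i) + b * c * (\<Sum>i\<in>I. x i * p i) + b * e * (\<Sum>i\<in>I. x i * f i)"
  by (simp add: sum.distrib sum_distrib_left algebra_simps)

section \<open>Explicit decompositions for segments and for centred ellipsoids\<close>

text \<open>
  The endpoints \<open>P\<close>, \<open>Q\<close> of the segment are put on two opposite edges: the chord through \<open>(0, 0, 1)\<close>
  and \<open>Q\<close> and the chord through \<open>(0, 1, 0)\<close> and \<open>P\<close>. They remain proper when an endpoint is on the sphere.
\<close>
lemma tangent_data_segment:
  assumes "\<bar>\<delta>\<bar> + s1 \<le> 1" "s1 > 0"
  shows "\<exists>x y z p f g h. tangent_data \<delta> s1 0 0 x y z p f g h"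
proof -
  define P where "P = \<delta> - s1"
  define Q where "Q = \<delta> + s1"
  have PQ: "P < Q" "\<bar>P\<bar> \<le> 1" "\<bar>Q\<bar> \<le> 1" using assms by (auto simp: P_def Q_def)
  have sq: "P\<^sup>2 \<le> 1" "Q\<^sup>2 \<le> 1" using PQ by (simp_all add: abs_square_le_1)
  have pos: "1 + P\<^sup>2 > 0" "1 + Q\<^sup>2 > 0" by (simp_all add: add_pos_nonneg)
  \<comment> \<open>Vertices 1 and 3 are the second intersections of the two chords with the unit
    sphere, found by inverse stereographic projection of \<open>Q\<close> from
    \<open>(0, 0, 1)\<close> and of \<open>P\<close> from \<open>(0, 1, 0)\<close>.\<close>
  define x where "x = quad 0 (2 * Q / (1 + Q\<^sup>2)) 0 (2 * P / (1 + P\<^sup>2))"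
  define y where "y = quad 0 0 1 ((P\<^sup>2 - 1) / (1 + P\<^sup>2))"
  define z where "z = quad 1 ((Q\<^sup>2 - 1) / (1 + Q\<^sup>2)) 0 0"
  \<comment> \<open>Chosen so that \<open>p + f\<close> and \<open>p - f\<close> are the barycentric
    coordinates of the endpoints \<open>Q\<close> and \<open>P\<close>, each supported on its own
    chord.\<close>
  define p where "p = quad ((1 - Q\<^sup>2) / 4) ((1 + Q\<^sup>2) / 4) ((1 - P\<^sup>2) / 4) ((1 + P\<^sup>2) / 4)"
  define f where "f = quad ((1 - Q\<^sup>2) / 4) ((1 + Q\<^sup>2) / 4) (- ((1 - P\<^sup>2) / 4)) (- ((1 + P\<^sup>2) / 4))"
  have chord: "(2 * T / (1 + T\<^sup>2))\<^sup>2 + ((T\<^sup>2 - 1) / (1 + T\<^sup>2))\<^sup>2 = 1" if "1 + T\<^sup>2 > 0" for T :: real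
    using that by (simp add: power_divide flip: add_divide_distrib) (simp add: power2_eq_square algebra_simps)
  have indep: "\<forall>i<4. \<mu> i = 0" if "(\<Sum>i<4. \<mu> i) = 0" "(\<Sum>i<4. x i * \<mu> i) = 0"
      "(\<Sum>i<4. y i * \<mu> i) = 0" "(\<Sum>i<4. z i * \<mu> i) = 0" for \<mu>
  proof -
    define m1 where "m1 = \<mu> 1 / (1 + Q\<^sup>2)"
    define m3 where "m3 = \<mu> 3 / (1 + P\<^sup>2)"
    have m: "\<mu> 1 = m1 * (1 + Q\<^sup>2)" "\<mu> 3 = m3 * (1 + P\<^sup>2)" using pos by (simp_all add: m1_def m3_def)
    have "2 * Q / (1 + Q\<^sup>2) * \<mu> 1 = 2 * (Q * m1)" "(Q\<^sup>2 - 1) / (1 + Q\<^sup>2) * \<mu> 1 = m1 * (Q\<^sup>2 - 1)"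
      "2 * P / (1 + P\<^sup>2) * \<mu> 3 = 2 * (P * m3)" "(P\<^sup>2 - 1) / (1 + P\<^sup>2) * \<mu> 3 = m3 * (P\<^sup>2 - 1)"
      by (simp_all add: m1_def m3_def)
    hence 1: "\<mu> 0 + m1 * (Q\<^sup>2 - 1) = 0" "\<mu> 2 + m3 * (P\<^sup>2 - 1) = 0" "Q * m1 + P * m3 = 0"
      using that by (auto simp: sum_less_4 x_def y_def z_def)
    have "\<mu> 0 + \<mu> 2 + m1 * (1 + Q\<^sup>2) + m3 * (1 + P\<^sup>2) = 0"
      using that m by (simp add: sum_less_4)
    with 1 have 2: "m1 + m3 = 0" by (simp add: algebra_simps)
    \<comment> \<open>The factor is \<open>Q - P = 2 * s1 > 0\<close>: the two chords meet the axis
      at different points, so they are skew.\<close>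
    have "m1 * (Q - P) = 0" using 1(3) 2 by algebra
    hence "m1 = 0" "m3 = 0" using PQ 2 by auto
    thus ?thesis using 1 m by (simp add: all_less_4)
  qed
  have "tangent_data \<delta> s1 0 0 x y z p f (\<lambda>_. 0) (\<lambda>_. 0)"
    unfolding tangent_data_def
  proof (intro conjI allI impI)
    fix \<mu> :: "nat \<Rightarrow> real" and i :: nat
    assume "(\<Sum>i<4. \<mu> i) = 0 \<and> (\<Sum>i<4. x i * \<mu> i) = 0 \<and> (\<Sum>i<4. y i * \<mu> i) = 0 \<and> (\<Sum>i<4. z i * \<mu> i) = 0" "i < 4"
    thus "\<mu> i = 0" using indep by blast
  next
    fix i :: nat assume "i < 4"
    hence "i \<in> {0,1,2,3}" by auto
    thus "(x i)\<^sup>2 + (y i)\<^sup>2 + (z i)\<^sup>2 = 1" "0 \<le> p i" "(p i)\<^sup>2 = (f i)\<^sup>2 + 0\<^sup>2 + 0\<^sup>2"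
      using chord[OF pos(1)] chord[OF pos(2)] sq pos
      by (auto simp: x_def y_def z_def p_def f_def power2_eq_square algebra_simps)
  next
    have "x 0 = 0" "x 1 * p 1 = Q / 2" "x 2 = 0" "x 3 * p 3 = P / 2"
      "x 1 * f 1 = Q / 2" "x 3 * f 3 = - P / 2"
      using pos by (simp_all add: x_def p_def f_def field_simps)
    thus "(\<Sum>i<4. x i * p i) = \<delta>" "(\<Sum>i<4. x i * f i) = s1"
      by (simp_all add: sum_less_4 P_def Q_def field_simps)
  qed (use pos in \<open>auto simp: sum_less_4 x_def y_def z_def p_def f_def field_simps\<close>)
  thus ?thesis by blast
qed

text \<open>
  Vertices \<open>(\<plusminus>A, \<plusminus>B, \<plusminus>C)\<close> with an even number of minus signs and equal weights work as soon as
  \<open>A\<^sup>2 + B\<^sup>2 + C\<^sup>2 = 1\<close> and \<open>(t1/A)\<^sup>2 + (t2/B)\<^sup>2 + (t3/C)\<^sup>2 = 1\<close>. The latter sum is at most 1 for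
  \<open>A\<^sup>2 = t1 + e\<close>, \<open>B\<^sup>2 = t2 + e\<close>, \<open>C\<^sup>2 = t3 + e\<close> and becomes large when \<open>B\<close> is shrunk by the factor \<open>\<surd>\<tau>\<close>.
\<close>
lemma tangent_data_strict:
  assumes nn: "t1 \<ge> 0" "t2 > 0" "t3 \<ge> 0" and lt: "t1 + t2 + t3 < 1"
  shows "\<exists>x y z p f g h. tangent_data 0 t1 t2 t3 x y z p f g h"
proof -
  define e where "e = (1 - (t1 + t2 + t3)) / 3"
  have e: "e > 0" "t1 + t2 + t3 + 3 * e = 1" using lt by (auto simp: e_def field_simps)
  \<comment> \<open>\<open>\<phi> \<tau>\<close> is the tangency sum when
    \<open>\<tau> * (t2 + e)\<close> is the square of \<open>B\<close> and the amount removed from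
    it is shared equally by the squares of \<open>A\<close> and \<open>C\<close>, which keeps their
    total at 1.\<close>
  define \<phi> where "\<phi> \<tau> = t2\<^sup>2 / (\<tau> * (t2 + e)) + (t1\<^sup>2 / (t1 + e + (1 - \<tau>) * (t2 + e) / 2)
     + t3\<^sup>2 / (t3 + e + (1 - \<tau>) * (t2 + e) / 2))" for \<tau>
  \<comment> \<open>At this value the \<open>t2\<close> term of \<open>\<phi>\<close> alone equals
    1.\<close>
  define \<tau>0 where "\<tau>0 = t2\<^sup>2 / (t2 + e)"
  have t2e: "t2\<^sup>2 < t2 + e" using nn lt e by (simp add: power2_eq_square) (smt (verit) mult_left_le)
  have \<tau>0: "0 < \<tau>0" "\<tau>0 \<le> 1" using nn e t2e by (simp_all add: \<tau>0_def)
  have den: "t1 + e + (1 - \<tau>) * (t2 + e) / 2 > 0" "t3 + e + (1 - \<tau>) * (t2 + e) / 2 > 0"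
    if "\<tau> \<le> 1" for \<tau>
  proof -
    have "(1 - \<tau>) * (t2 + e) / 2 \<ge> 0" using that nn e by simp
    thus "t1 + e + (1 - \<tau>) * (t2 + e) / 2 > 0" "t3 + e + (1 - \<tau>) * (t2 + e) / 2 > 0"
      using nn e by linarith+
  qed
  have "\<phi> \<tau>0 \<ge> 1"
  proof -
    have "t2\<^sup>2 / (\<tau>0 * (t2 + e)) = 1" using nn e by (simp add: \<tau>0_def)
    thus ?thesis using den[OF \<tau>0(2)] nn by (simp add: \<phi>_def add_nonneg_nonneg less_imp_le)
  qed
  moreover have "\<phi> 1 \<le> 1"
  proof -
    have "t\<^sup>2 / (t + e) \<le> t" if "t \<ge> 0" for t
      using that e by (simp add: power2_eq_square field_simps)
    from this[OF nn(1)] this[of t2] this[OF nn(3)] show ?thesis using nn e by (simp add: \<phi>_def)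
  qed
  moreover have "continuous_on {\<tau>0..1} \<phi>"
    unfolding \<phi>_def using \<tau>0 nn e den by (intro continuous_intros) (force simp: less_le)+
  ultimately obtain \<tau> where \<tau>: "\<tau>0 \<le> \<tau>" "\<tau> \<le> 1" "\<phi> \<tau> = 1"
    using IVT2'[of \<phi> 1 1 \<tau>0] \<tau>0 by auto
  define A where "A = sqrt (t1 + e + (1 - \<tau>) * (t2 + e) / 2)"
  define B where "B = sqrt (\<tau> * (t2 + e))"
  define C where "C = sqrt (t3 + e + (1 - \<tau>) * (t2 + e) / 2)"
  have pos: "A > 0" "B > 0" "C > 0" using den[OF \<tau>(2)] \<tau> \<tau>0 nn e by (auto simp: A_def B_def C_def)
  have sq: "A\<^sup>2 = t1 + e + (1 - \<tau>) * (t2 + e) / 2" "B\<^sup>2 = \<tau> * (t2 + e)"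
    "C\<^sup>2 = t3 + e + (1 - \<tau>) * (t2 + e) / 2"
    using pos unfolding A_def B_def C_def by auto
  have ABC: "A\<^sup>2 + B\<^sup>2 + C\<^sup>2 = 1" using e unfolding sq by (simp add: field_simps)
  have tABC: "(t1 / A)\<^sup>2 + (t2 / B)\<^sup>2 + (t3 / C)\<^sup>2 = 1"
    using \<tau>(3) unfolding \<phi>_def sq[symmetric] by (simp add: power_divide)
  define x where "x = quad A A (- A) (- A)"
  define y where "y = quad B (- B) B (- B)"
  define z where "z = quad C (- C) (- C) C"
  \<comment> \<open>The sign patterns are mutually orthogonal and orthogonal to the constant vector,
    so all mixed sums vanish; the factor 1/4 compensates for the four equal contributions to each
    diagonal sum.\<close>
  define f where "f = quad (t1 / A / 4) (t1 / A / 4) (- (t1 / A / 4)) (- (t1 / A / 4))"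
  define g where "g = quad (t2 / B / 4) (- (t2 / B / 4)) (t2 / B / 4) (- (t2 / B / 4))"
  define h where "h = quad (t3 / C / 4) (- (t3 / C / 4)) (- (t3 / C / 4)) (t3 / C / 4)"
  have indep: "\<forall>i<4. \<mu> i = 0" if "(\<Sum>i<4. \<mu> i) = 0" "(\<Sum>i<4. x i * \<mu> i) = 0"
      "(\<Sum>i<4. y i * \<mu> i) = 0" "(\<Sum>i<4. z i * \<mu> i) = 0" for \<mu>
  proof -
    have "A * (\<mu> 0 + \<mu> 1 - \<mu> 2 - \<mu> 3) = 0" "B * (\<mu> 0 - \<mu> 1 + \<mu> 2 - \<mu> 3) = 0" "C * (\<mu> 0 - \<mu> 1 - \<mu> 2 + \<mu> 3) = 0"
      using that by (auto simp: sum_less_4 x_def y_def z_def algebra_simps)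
    hence "\<mu> 0 + \<mu> 1 - \<mu> 2 - \<mu> 3 = 0" "\<mu> 0 - \<mu> 1 + \<mu> 2 - \<mu> 3 = 0" "\<mu> 0 - \<mu> 1 - \<mu> 2 + \<mu> 3 = 0"
      using pos by auto
    thus ?thesis using that(1) by (simp add: all_less_4 sum_less_4)
  qed
  have "tangent_data 0 t1 t2 t3 x y z (\<lambda>_. 1/4) f g h"
    unfolding tangent_data_def
  proof (intro conjI allI impI)
    fix \<mu> :: "nat \<Rightarrow> real" and i :: nat
    assume "(\<Sum>i<4. \<mu> i) = 0 \<and> (\<Sum>i<4. x i * \<mu> i) = 0 \<and> (\<Sum>i<4. y i * \<mu> i) = 0 \<and> (\<Sum>i<4. z i * \<mu> i) = 0" "i < 4"
    thus "\<mu> i = 0" using indep by blast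
  next
    fix i :: nat assume "i < 4"
    hence i: "i \<in> {0,1,2,3}" by auto
    thus "(x i)\<^sup>2 + (y i)\<^sup>2 + (z i)\<^sup>2 = 1" using ABC by (auto simp: x_def y_def z_def)
    have "(f i)\<^sup>2 = (t1 / A)\<^sup>2 / 16" "(g i)\<^sup>2 = (t2 / B)\<^sup>2 / 16" "(h i)\<^sup>2 = (t3 / C)\<^sup>2 / 16"
      using i by (auto simp: f_def g_def h_def power_divide)
    thus "(1/4)\<^sup>2 = (f i)\<^sup>2 + (g i)\<^sup>2 + (h i)\<^sup>2" using tABC by (simp add: power_divide)
  qed (use pos in \<open>auto simp: sum_less_4 x_def y_def z_def f_def g_def h_def\<close>)
  thus ?thesis by blast
qed

text \<open>
  For \<open>t3 = 0\<close> the sign-symmetric tetrahedron would be flat. Instead, one face is the tangent plane at the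
  end of an axis, the apex is antipodal to it, and the base is an isosceles triangle chosen in the same way.
\<close>
lemma tangent_data_tight:
  assumes nn: "t1 \<ge> 0" "t2 > 0" "t3 \<ge> 0" and eq: "t1 + t2 + t3 = 1"
  shows "\<exists>x y z p f g h. tangent_data 0 t1 t2 t3 x y z p f g h"
proof -
  \<comment> \<open>The same problem one dimension lower: in the unit circle the ellipse with
    semiaxes \<open>1 - q\<close> and \<open>q\<close> has its triangle with apex at height 1 and
    base at height \<open>-q\<close>. Scaled by \<open>\<rho>\<close>, this is the face in the plane
    \<open>x = -t1\<close>.\<close>
  define q where "q = t3 / (1 - t1)"
  have q: "0 \<le> q" "q < 1" "t3 = q * (1 - t1)"
    using nn eq by (auto simp: q_def field_simps)
  have t2: "t2 = (1 - q) * (1 - t1)"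
    using eq q(3) by (simp add: algebra_simps)
  have t1: "t1 < 1" using nn eq by linarith
  define \<rho> where "\<rho> = sqrt (1 - t1\<^sup>2)"
  define k where "k = sqrt (1 - q\<^sup>2)"
  have "t1\<^sup>2 < 1" "q\<^sup>2 < 1" using nn t1 q by (simp_all add: abs_square_less_1)
  hence \<rho>: "\<rho> > 0" "\<rho>\<^sup>2 = 1 - t1\<^sup>2" and k: "k > 0" "k\<^sup>2 = 1 - q\<^sup>2" by (simp_all add: \<rho>_def k_def)
  define w where "w = 1 / ((1 + t1) * (1 + q))"
  have w: "w > 0" "w * (1 + t1) * (1 + q) = 1" using nn q by (auto simp: w_def)
  define x where "x = quad 1 (- t1) (- t1) (- t1)"
  define y where "y = quad 0 0 (\<rho> * k) (- (\<rho> * k))"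
  define z where "z = quad 0 \<rho> (- (\<rho> * q)) (- (\<rho> * q))"
  \<comment> \<open>These are the barycentric coordinates of the centre of the sphere;
    \<open>w\<close> normalises their sum.\<close>
  define p where "p = quad (t1 * (1 + q) * w) (q * w) (w / 2) (w / 2)"
  have unit: "t1\<^sup>2 + (\<rho> * k)\<^sup>2 + (\<rho> * q)\<^sup>2 = 1" "t1\<^sup>2 + \<rho>\<^sup>2 = 1"
    using \<rho>(2) k(2) by algebra+
  have v: "(x i)\<^sup>2 + (y i)\<^sup>2 + (z i)\<^sup>2 = 1" "p i \<ge> 0" if "i < 4" for i
  proof -
    have i: "i \<in> {0,1,2,3}" using that by auto
    thus "(x i)\<^sup>2 + (y i)\<^sup>2 + (z i)\<^sup>2 = 1" using unit by (auto simp: x_def y_def z_def)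
    show "p i \<ge> 0" using i w q nn by (auto simp: p_def)
  qed
  have indep: "\<forall>i<4. \<mu> i = 0" if "(\<Sum>i<4. \<mu> i) = 0" "(\<Sum>i<4. x i * \<mu> i) = 0"
      "(\<Sum>i<4. y i * \<mu> i) = 0" "(\<Sum>i<4. z i * \<mu> i) = 0" for \<mu>
  proof -
    have 0: "\<mu> 0 + \<mu> 1 + \<mu> 2 + \<mu> 3 = 0" using that by (simp add: sum_less_4)
    have "\<mu> 0 - t1 * (\<mu> 1 + \<mu> 2 + \<mu> 3) = 0" "(\<rho> * k) * (\<mu> 2 - \<mu> 3) = 0" "\<rho> * (\<mu> 1 - q * (\<mu> 2 + \<mu> 3)) = 0"
      using that by (auto simp: sum_less_4 x_def y_def z_def algebra_simps)
    hence 1: "\<mu> 0 - t1 * (\<mu> 1 + \<mu> 2 + \<mu> 3) = 0" "\<mu> 2 = \<mu> 3" "\<mu> 1 = q * (\<mu> 2 + \<mu> 3)"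
      using \<rho> k by auto
    have "\<mu> 0 * (1 + t1) = 0" using 0 1 by algebra
    hence 2: "\<mu> 0 = 0" using nn by auto
    have "\<mu> 3 * (2 * (1 + q)) = 0" using 0 1 2 by algebra
    hence "\<mu> 3 = 0" using q by auto
    thus ?thesis using 1 2 by (simp add: all_less_4)
  qed
  \<comment> \<open>With \<open>(p, w) = p * (1, v)\<close> tangency is automatic, and the semiaxes
    become the second moments of the weighted vertices. Their sum is 1 because all vertices are unit
    vectors.\<close>
  have "tangent_data 0 t1 t2 t3 x y z p (\<lambda>i. p i * x i) (\<lambda>i. p i * y i) (\<lambda>i. p i * z i)"
    unfolding tangent_data_def
  proof (intro conjI allI impI)
    fix \<mu> :: "nat \<Rightarrow> real" and i :: nat
    assume "(\<Sum>i<4. \<mu> i) = 0 \<and> (\<Sum>i<4. x i * \<mu> i) = 0 \<and> (\<Sum>i<4. y i * \<mu> i) = 0 \<and> (\<Sum>i<4. z i * \<mu> i) = 0" "i < 4"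
    thus "\<mu> i = 0" using indep by blast
  next
    fix i :: nat assume i: "i < 4"
    show "(x i)\<^sup>2 + (y i)\<^sup>2 + (z i)\<^sup>2 = 1" "p i \<ge> 0" using v[OF i] by auto
    have "(p i * x i)\<^sup>2 + (p i * y i)\<^sup>2 + (p i * z i)\<^sup>2 = (p i)\<^sup>2 * ((x i)\<^sup>2 + (y i)\<^sup>2 + (z i)\<^sup>2)"
      by (simp add: power_mult_distrib algebra_simps)
    thus "(p i)\<^sup>2 = (p i * x i)\<^sup>2 + (p i * y i)\<^sup>2 + (p i * z i)\<^sup>2" using v[OF i] by simp
  next
    have "(\<Sum>i<4. p i) = w * (1 + t1) * (1 + q)"
      by (simp add: sum_less_4 p_def algebra_simps)
    thus "(\<Sum>i<4. p i) = 1" using w by simp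
    have "(\<Sum>i<4. x i * (p i * x i)) = t1 * (w * (1 + t1) * (1 + q))"
      by (simp add: sum_less_4 p_def x_def algebra_simps)
    thus "(\<Sum>i<4. x i * (p i * x i)) = t1" using w by simp
    have "(\<Sum>i<4. y i * (p i * y i)) = w * \<rho>\<^sup>2 * k\<^sup>2"
      by (simp add: sum_less_4 p_def y_def algebra_simps power2_eq_square)
    also have "\<dots> = (w * (1 + t1) * (1 + q)) * ((1 - q) * (1 - t1))"
      unfolding \<rho> k by (simp add: algebra_simps power2_eq_square)
    finally show "(\<Sum>i<4. y i * (p i * y i)) = t2" using w t2 by simp
    have "(\<Sum>i<4. z i * (p i * z i)) = w * \<rho>\<^sup>2 * q * (1 + q)"
      by (simp add: sum_less_4 p_def z_def algebra_simps power2_eq_square)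
    also have "\<dots> = (w * (1 + t1) * (1 + q)) * (q * (1 - t1))"
      unfolding \<rho> by (simp add: algebra_simps power2_eq_square)
    finally show "(\<Sum>i<4. z i * (p i * z i)) = t3" using w q by simp
  qed (auto simp: sum_less_4 x_def y_def z_def p_def algebra_simps)
  thus ?thesis by blast
qed

lemma tangent_data_centred:
  assumes "t1 \<ge> 0" "t2 \<ge> 0" "t3 \<ge> 0" "t2 + t3 > 0" "t1 + t2 + t3 \<le> 1"
  shows "\<exists>x y z p f g h. tangent_data 0 t1 t2 t3 x y z p f g h"
proof -
  have *: "\<exists>x y z p f g h. tangent_data 0 t1 a b x y z p f g h" if "a > 0" "b \<ge> 0" "t1 + a + b \<le> 1" for a b
    using tangent_data_strict[of t1 a b] tangent_data_tight[of t1 a b] that assms(1) by fastforce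
  show ?thesis
  proof (cases "t2 > 0")
    case True
    thus ?thesis using * assms by simp
  next
    \<comment> \<open>Here \<open>t2 = 0\<close>, hence \<open>t3 > 0\<close>, and the second and
      third axes trade places.\<close>
    case False
    hence "\<exists>x y z p f g h. tangent_data 0 t1 t3 t2 x y z p f g h" using * assms by simp
    thus ?thesis using tangent_data_swap by blast
  qed
qed

section \<open>Boosts and the general decomposition\<close>

text \<open>
  Lorentz boosts along the first axis act on the vectors \<open>(1, v i)\<close>, which are then rescaled by \<open>1 / k i\<close>
  to have first entry 1 again, and on \<open>(p i, f i, g i, h i)\<close>. In the light-cone coordinates \<open>1 \<plusminus> x\<close> and
  \<open>p \<plusminus> f\<close> they are the scalings by \<open>A\<close>, \<open>1/A\<close> and \<open>B\<close>, \<open>1/B\<close>.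
\<close>
lemma tangent_data_boost:
  assumes D: "tangent_data 0 t1 t2 t3 x y z p f g h"
    and pos: "A > 0" "B > 0" "m > 0"
    and N: "m * (1 + t1) * (A * B) = 1 + \<delta> + s1" "m * (1 - t1) * (A / B) = 1 + \<delta> - s1"
      "m * (1 - t1) * (B / A) = 1 - \<delta> - s1" "m * (1 + t1) / (A * B) = 1 - \<delta> + s1"
  shows "\<exists>x y z p f g h. tangent_data \<delta> s1 (m * t2) (m * t3) x y z p f g h"
proof -
  \<comment> \<open>Hyperbolic cosine and sine of \<open>ln A\<close> and of \<open>ln B\<close>:
    the matrix entries of the two boosts.\<close>
  define C S where "C = (A + 1 / A) / 2" and "S = (A - 1 / A) / 2"
  define K L where "K = (B + 1 / B) / 2" and "L = (B - 1 / B) / 2"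
  have CS: "C\<^sup>2 - S\<^sup>2 = 1" "K\<^sup>2 - L\<^sup>2 = 1"
    using pos by (auto simp: C_def S_def K_def L_def power2_eq_square field_simps)
  have gt: "C > \<bar>S\<bar>" "K > \<bar>L\<bar>" using pos by (auto simp: C_def S_def K_def L_def abs_if field_simps)
  \<comment> \<open>\<open>k i\<close> is the first entry of the boosted \<open>(1, v i)\<close>.
    Dividing the vertex by it and multiplying the weights by it leaves the tensor product
    unchanged.\<close>
  define k where "k i = C + S * x i" for i
  define X where "X i = (S + C * x i) / k i" for i
  define P where "P i = m * (k i * (K * p i + L * f i))" for i
  define F where "F i = m * (k i * (L * p i + K * f i))" for i
  note D' = D[unfolded tangent_data_def]
  \<comment> \<open>The hypotheses \<open>N\<close> give the boosted matrix block in light-cone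
    coordinates; here it is read off in the original ones.\<close>
  have boosted: "m * (C * K + S * L * t1) = 1" "m * (C * L + S * K * t1) = 0"
    "m * (S * K + C * L * t1) = \<delta>" "m * (S * L + C * K * t1) = s1"
  proof -
    have "4 * (m * (C * K + S * L * t1)) = m * (1 + t1) * (A * B) + m * (1 - t1) * (A / B) + m * (1 - t1) * (B / A) + m * (1 + t1) / (A * B)"
      "4 * (m * (C * L + S * K * t1)) = m * (1 + t1) * (A * B) - m * (1 - t1) * (A / B) + m * (1 - t1) * (B / A) - m * (1 + t1) / (A * B)"
      "4 * (m * (S * K + C * L * t1)) = m * (1 + t1) * (A * B) + m * (1 - t1) * (A / B) - m * (1 - t1) * (B / A) - m * (1 + t1) / (A * B)"
      "4 * (m * (S * L + C * K * t1)) = m * (1 + t1) * (A * B) - m * (1 - t1) * (A / B) - m * (1 - t1) * (B / A) + m * (1 + t1) / (A * B)"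
      using pos by (simp_all add: C_def S_def K_def L_def field_simps)
    thus "m * (C * K + S * L * t1) = 1" "m * (C * L + S * K * t1) = 0"
      "m * (S * K + C * L * t1) = \<delta>" "m * (S * L + C * K * t1) = s1"
      unfolding N by simp_all
  qed
  \<comment> \<open>A boost keeps the forward cone: \<open>C\<close> exceeds the modulus of
    \<open>S\<close>, and \<open>x i\<close> lies between -1 and 1.\<close>
  have k: "k i > 0" if "i < 4" for i
  proof -
    have "(x i)\<^sup>2 + (y i)\<^sup>2 + (z i)\<^sup>2 = 1" using D' that by blast
    hence "(x i)\<^sup>2 \<le> 1" using zero_le_power2[of "y i"] zero_le_power2[of "z i"] by linarith
    hence "\<bar>x i\<bar> \<le> 1" by (simp add: abs_square_le_1)
    hence "\<bar>S * x i\<bar> \<le> \<bar>S\<bar>" by (simp add: abs_mult mult_left_le)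
    thus ?thesis using gt by (simp add: k_def)
  qed
  have kX: "k i * X i = S + C * x i" if "i < 4" for i using k[OF that] by (simp add: X_def)
  have "tangent_data \<delta> s1 (m * t2) (m * t3) X (\<lambda>i. y i / k i) (\<lambda>i. z i / k i) P F
      (\<lambda>i. m * (k i * g i)) (\<lambda>i. m * (k i * h i))"
    unfolding tangent_data_def
  proof (intro conjI allI impI)
    fix \<mu> :: "nat \<Rightarrow> real" and i :: nat
    assume \<mu>: "(\<Sum>i<4. \<mu> i) = 0 \<and> (\<Sum>i<4. X i * \<mu> i) = 0 \<and> (\<Sum>i<4. y i / k i * \<mu> i) = 0 \<and> (\<Sum>i<4. z i / k i * \<mu> i) = 0"
      and i: "i < 4"
    \<comment> \<open>An affine dependence of the new vertices is, up to the factors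
      \<open>k i\<close>, a linear dependence of the boosted vectors \<open>(1, v i)\<close>, and
      the boost is invertible with determinant 1.\<close>
    define \<nu> where "\<nu> i = \<mu> i / k i" for i
    have "\<mu> i = k i * \<nu> i" if "i < 4" for i using k[OF that] by (simp add: \<nu>_def)
    hence "(\<Sum>i<4. \<mu> i) = (\<Sum>i<4. C * \<nu> i + S * (x i * \<nu> i))"
      by (intro sum.cong) (auto simp: k_def algebra_simps)
    moreover have "(\<Sum>i<4. X i * \<mu> i) = (\<Sum>i<4. S * \<nu> i + C * (x i * \<nu> i))"
      by (intro sum.cong) (auto simp: \<nu>_def X_def field_simps add_divide_distrib)
    ultimately have "C * sum \<nu> {..<4} + S * (\<Sum>i<4. x i * \<nu> i) = 0"
      "S * sum \<nu> {..<4} + C * (\<Sum>i<4. x i * \<nu> i) = 0"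
      using \<mu> by (simp_all add: sum.distrib sum_distrib_left)
    hence "(C\<^sup>2 - S\<^sup>2) * sum \<nu> {..<4} = 0" "(C\<^sup>2 - S\<^sup>2) * (\<Sum>i<4. x i * \<nu> i) = 0" by algebra+
    hence "sum \<nu> {..<4} = 0" "(\<Sum>i<4. x i * \<nu> i) = 0" unfolding CS by simp_all
    moreover have "(\<Sum>i<4. y i * \<nu> i) = 0" "(\<Sum>i<4. z i * \<nu> i) = 0" using \<mu> by (simp_all add: \<nu>_def)
    ultimately have "\<nu> i = 0" using D' i by blast
    thus "\<mu> i = 0" using k[OF i] by (simp add: \<nu>_def)
  next
    fix i :: nat assume i: "i < 4"
    have v: "(x i)\<^sup>2 + (y i)\<^sup>2 + (z i)\<^sup>2 = 1" "0 \<le> p i" "(p i)\<^sup>2 = (f i)\<^sup>2 + (g i)\<^sup>2 + (h i)\<^sup>2"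
      using D' i by auto
    have "(S + C * x i)\<^sup>2 + (y i)\<^sup>2 + (z i)\<^sup>2 = (k i)\<^sup>2"
      using v(1) CS(1) unfolding k_def by algebra
    thus "(X i)\<^sup>2 + (y i / k i)\<^sup>2 + (z i / k i)\<^sup>2 = 1"
      using k[OF i] by (simp add: X_def power_divide flip: add_divide_distrib)
    have "(f i)\<^sup>2 \<le> (p i)\<^sup>2" using v(3) by simp
    hence "\<bar>f i\<bar> \<le> p i" using v(2) by (simp add: abs_le_square_iff[symmetric])
    hence "\<bar>L * f i\<bar> \<le> K * p i" using gt by (simp add: abs_mult mult_mono)
    thus "0 \<le> P i" using pos k[OF i] by (simp add: P_def)
    have "(K * p i + L * f i)\<^sup>2 = (L * p i + K * f i)\<^sup>2 + (g i)\<^sup>2 + (h i)\<^sup>2"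
      using v(3) CS(2) by algebra
    thus "(P i)\<^sup>2 = (F i)\<^sup>2 + (m * (k i * g i))\<^sup>2 + (m * (k i * h i))\<^sup>2"
      unfolding P_def F_def by algebra
  next
    have P': "P i = m * ((C + S * x i) * (K * p i + L * f i))"
      and F': "F i = m * ((C + S * x i) * (L * p i + K * f i))" for i
      by (simp_all add: P_def F_def k_def)
    have P'': "X i * P i = m * ((S + C * x i) * (K * p i + L * f i))"
      and F'': "X i * F i = m * ((S + C * x i) * (L * p i + K * f i))" if "i < 4" for i
      using kX[OF that] unfolding P_def F_def by algebra+
    show "sum P {..<4} = 1" "sum F {..<4} = 0"
      unfolding P' F' sum_distrib_left[symmetric] sum_bilinear using D' boosted
      by (simp_all add: algebra_simps)
    have "(\<Sum>i<4. X i * P i) = (\<Sum>i<4. m * ((S + C * x i) * (K * p i + L * f i)))"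
      "(\<Sum>i<4. X i * F i) = (\<Sum>i<4. m * ((S + C * x i) * (L * p i + K * f i)))"
      using P'' F'' by (auto intro!: sum.cong)
    thus "(\<Sum>i<4. X i * P i) = \<delta>" "(\<Sum>i<4. X i * F i) = s1"
      unfolding sum_distrib_left[symmetric] sum_bilinear using D' boosted
      by (simp_all add: algebra_simps)
    have yP: "u / k i * P i = m * (u * (K * p i + L * f i))" 
      "u / k i * F i = m * (u * (L * p i + K * f i))" 
      "u / k i * (m * (k i * n)) = m * (u * n)" if "i < 4" for i u n
      using k[OF that] by (simp_all add: P_def F_def)
    have lin: "(\<Sum>i<4. w i * (c * p i + e * f i)) = c * (\<Sum>i<4. w i * p i) + e * (\<Sum>i<4. w i * f i)" for w c e
      using sum_bilinear[of 0 1 w c p e f] by simp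
    have "(\<Sum>i<4. w i / k i * P i) = (\<Sum>i<4. m * (w i * (K * p i + L * f i)))"
      "(\<Sum>i<4. w i / k i * F i) = (\<Sum>i<4. m * (w i * (L * p i + K * f i)))"
      "(\<Sum>i<4. w i / k i * (m * (k i * n i))) = (\<Sum>i<4. m * (w i * n i))" for w n
      using yP by (auto intro!: sum.cong)
    hence s: "(\<Sum>i<4. w i / k i * P i) = m * (K * (\<Sum>i<4. w i * p i) + L * (\<Sum>i<4. w i * f i))"
      "(\<Sum>i<4. w i / k i * F i) = m * (L * (\<Sum>i<4. w i * p i) + K * (\<Sum>i<4. w i * f i))"
      "(\<Sum>i<4. w i / k i * (m * (k i * n i))) = m * (\<Sum>i<4. w i * n i)" for w n
      by (simp_all add: lin flip: sum_distrib_left)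
    show "(\<Sum>i<4. y i / k i * P i) = 0" "(\<Sum>i<4. y i / k i * F i) = 0"
      "(\<Sum>i<4. y i / k i * (m * (k i * g i))) = m * t2" "(\<Sum>i<4. y i / k i * (m * (k i * h i))) = 0"
      "(\<Sum>i<4. z i / k i * P i) = 0" "(\<Sum>i<4. z i / k i * F i) = 0"
      "(\<Sum>i<4. z i / k i * (m * (k i * g i))) = 0" "(\<Sum>i<4. z i / k i * (m * (k i * h i))) = m * t3"
      unfolding s using D' by simp_all
    have "(\<Sum>i<4. m * (k i * n i)) = m * (C * sum n {..<4} + S * (\<Sum>i<4. x i * n i))" for n
      by (simp add: k_def sum.distrib sum_distrib_left algebra_simps)
    thus "(\<Sum>i<4. m * (k i * g i)) = 0" "(\<Sum>i<4. m * (k i * h i)) = 0" using D' by simp_all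
    have "(\<Sum>i<4. X i * (m * (k i * n i))) = (\<Sum>i<4. m * (S * n i + C * (x i * n i)))" for n
    proof (rule sum.cong)
      fix i :: nat assume "i \<in> {..<4}"
      thus "X i * (m * (k i * n i)) = m * (S * n i + C * (x i * n i))" using kX[of i] by simp algebra
    qed simp
    also have "\<dots> n = m * (S * sum n {..<4} + C * (\<Sum>i<4. x i * n i))" for n
      by (simp add: sum.distrib sum_distrib_left algebra_simps)
    finally show "(\<Sum>i<4. X i * (m * (k i * g i))) = 0" "(\<Sum>i<4. X i * (m * (k i * h i))) = 0"
      using D' by simp_all
  qed
  thus ?thesis by blast
qed

text \<open>Boosts preserve the products \<open>N1 * N4\<close> and \<open>N2 * N3\<close> of
  light-cone entries. Comparison with the centred case forces \<open>m * (1 + t1)\<close> and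
  \<open>m * (1 - t1)\<close> to be their square roots \<open>u\<close> and \<open>v\<close>, and
  the bound on \<open>\<delta>\<close> becomes \<open>s2 + s3 \<le> v\<close>.\<close>

lemma tangent_data_exists:
  assumes nn: "s1 \<ge> 0" "s2 \<ge> 0" "s3 \<ge> 0" and "s1 \<le> 1" "s1 + s2 + s3 > 0"
    and cond: "\<delta>\<^sup>2 \<le> (1 - s1)\<^sup>2 - (s2 + s3)\<^sup>2"
  shows "\<exists>x y z p f g h. tangent_data \<delta> s1 s2 s3 x y z p f g h"
proof (cases "s2 + s3 = 0")
  case True
  hence "\<bar>\<delta>\<bar> \<le> \<bar>1 - s1\<bar>" using cond by (simp add: abs_le_square_iff)
  thus ?thesis using tangent_data_segment[of \<delta> s1] True assms by (simp add: add_nonneg_eq_0_iff)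
next
  case False
  hence "(s2 + s3)\<^sup>2 > 0" by simp
  \<comment> \<open>Strictness makes all four light-cone entries positive, so the required boosts
    exist.\<close>
  hence "\<delta>\<^sup>2 < (1 - s1)\<^sup>2" using cond by linarith
  hence "\<bar>\<delta>\<bar> < \<bar>1 - s1\<bar>" by (meson abs_le_square_iff not_less)
  hence \<delta>: "\<bar>\<delta>\<bar> < 1 - s1" using assms by simp
  define N1 N2 N3 N4 where "N1 = 1 + \<delta> + s1" and "N2 = 1 + \<delta> - s1" and "N3 = 1 - \<delta> - s1" and "N4 = 1 - \<delta> + s1"
  note N_def = N1_def N2_def N3_def N4_def
  have Npos: "N1 > 0" "N2 > 0" "N3 > 0" "N4 > 0" using \<delta> nn by (auto simp: N_def)
  define u v where "u = sqrt (N1 * N4)" and "v = sqrt (N2 * N3)"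
  have "N1 * N4 - N2 * N3 = 4 * s1" unfolding N_def by algebra
  hence uv: "v > 0" "v \<le> u" using Npos nn by (auto simp: u_def v_def)
  define m where "m = (u + v) / 2"
  define t1 where "t1 = (u - v) / (2 * m)"
  have m: "m > 0" using uv by (simp add: m_def)
  have mt: "m * (1 + t1) = u" "m * (1 - t1) = v"
  proof -
    have "m * t1 = (u - v) / 2" using m by (simp add: t1_def)
    hence "m + m * t1 = u" "m - m * t1 = v" by (simp_all only:) (simp_all add: m_def field_simps)
    thus "m * (1 + t1) = u" "m * (1 - t1) = v" by (simp_all add: algebra_simps)
  qed
  have "N2 * N3 = (1 - s1)\<^sup>2 - \<delta>\<^sup>2" unfolding N_def by algebra
  hence "(s2 + s3)\<^sup>2 \<le> N2 * N3" using cond by simp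
  hence "s2 + s3 \<le> v" using nn unfolding v_def by (simp add: real_le_rsqrt)
  hence "s2 + s3 \<le> m * (1 - t1)" using mt by simp
  hence "t1 + s2 / m + s3 / m \<le> 1" using m by (simp add: field_simps)
  moreover have "t1 \<ge> 0" "s2 / m \<ge> 0" "s3 / m \<ge> 0" using uv m nn by (simp_all add: t1_def)
  moreover have "s2 / m + s3 / m > 0" using False nn m by (simp flip: add_divide_distrib)
  ultimately obtain x y z p f g h where D: "tangent_data 0 t1 (s2 / m) (s3 / m) x y z p f g h"
    using tangent_data_centred by blast
  \<comment> \<open>The boost factors \<open>A = q * r\<close> and \<open>B = q / r\<close> must
    satisfy \<open>A * B = N1 / u\<close> and \<open>A / B = N2 / v\<close>, so the squares of
    \<open>q\<close> and \<open>r\<close> are these ratios; hence the fourth roots.\<close>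
  define q r where "q = sqrt (sqrt (N1 / N4))" and "r = sqrt (sqrt (N2 / N3))"
  have qr: "q > 0" "r > 0" using Npos by (simp_all add: q_def r_def)
  have q2: "q * q = sqrt N1 / sqrt N4" and r2: "r * r = sqrt N2 / sqrt N3"
    using Npos by (simp_all add: q_def r_def real_sqrt_divide)
  have sq: "sqrt N * sqrt N = N" if "N > 0" for N using that by simp
  have "u * (q * q) = N1" "u / (q * q) = N4" "v * (r * r) = N2" "v / (r * r) = N3"
    unfolding q2 r2 u_def v_def real_sqrt_mult using Npos sq by (simp_all add: field_simps)
  hence "u * ((q * r) * (q / r)) = N1" "v * ((q * r) / (q / r)) = N2"
    "v * ((q / r) / (q * r)) = N3" "u / ((q * r) * (q / r)) = N4"
    using qr by (simp_all add: field_simps)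
  hence "\<exists>x y z p f g h. tangent_data \<delta> s1 (m * (s2 / m)) (m * (s3 / m)) x y z p f g h"
    using tangent_data_boost[OF D _ _ m, of "q * r" "q / r" \<delta> s1] qr unfolding mt N_def by simp
  thus ?thesis using m by simp
qed

subsection \<open>Orthonormal frames and barycentric coordinates\<close>

lemma bary_unique:
  fixes C :: "'a::real_vector set"
  assumes "\<not> affine_dependent C" "finite C" "sum u C = sum w C" "(\<Sum>v\<in>C. u v *\<^sub>R v) = (\<Sum>v\<in>C. w v *\<^sub>R v)" "v \<in> C"
  shows "u v = w v"
proof (rule ccontr)
  assume "u v \<noteq> w v"
  hence "\<exists>v\<in>C. u v - w v \<noteq> 0" using assms by auto
  moreover have "(\<Sum>v\<in>C. u v - w v) = 0" "(\<Sum>v\<in>C. (u v - w v) *\<^sub>R v) = 0"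
    using assms by (simp_all add: sum_subtractf scaleR_diff_left)
  ultimately show False using assms(1,2) by (auto simp: affine_dependent_explicit_finite)
qed

lemma frame_inner:
  assumes "orthonormal_frame u1 u2 u3"
  shows "u1 \<bullet> u1 = 1" "u2 \<bullet> u2 = 1" "u3 \<bullet> u3 = 1" "u1 \<bullet> u2 = 0" "u2 \<bullet> u1 = 0"
    "u1 \<bullet> u3 = 0" "u3 \<bullet> u1 = 0" "u2 \<bullet> u3 = 0" "u3 \<bullet> u2 = 0"
  using assms by (auto simp: orthonormal_frame_def orthogonal_def norm_eq_1 inner_commute)

lemma frame_bessel:
  assumes "orthonormal_frame u1 u2 u3"
  shows "(v \<bullet> u1)\<^sup>2 + (v \<bullet> u2)\<^sup>2 + (v \<bullet> u3)\<^sup>2 \<le> (norm v)\<^sup>2"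
proof -
  let ?r = "v - (v \<bullet> u1) *\<^sub>R u1 - (v \<bullet> u2) *\<^sub>R u2 - (v \<bullet> u3) *\<^sub>R u3"
  have "?r \<bullet> ?r = v \<bullet> v - (v \<bullet> u1)\<^sup>2 - (v \<bullet> u2)\<^sup>2 - (v \<bullet> u3)\<^sup>2"
    using frame_inner[OF assms]
    by (simp add: inner_diff_left inner_diff_right inner_commute[of u1 v] inner_commute[of u2 v] inner_commute[of u3 v] power2_eq_square)
  thus ?thesis using inner_ge_zero[of ?r] by (simp add: power2_norm_eq_inner)
qed

lemma frame_norm:
  assumes "orthonormal_frame u1 u2 u3"
  shows "(norm (x *\<^sub>R u1 + y *\<^sub>R u2 + z *\<^sub>R u3))\<^sup>2 = x\<^sup>2 + y\<^sup>2 + z\<^sup>2"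
  using frame_inner[OF assms]
  by (simp add: power2_norm_eq_inner inner_add_left inner_add_right)
    (simp add: power2_eq_square)

lemma frame_collinear:
  assumes "norm u = 1" "collinear {0, d, u}"
  shows "d = (d \<bullet> u) *\<^sub>R u"
proof -
  obtain k where k: "d = k *\<^sub>R u"
    using assms by (metis (no_types) collinear_lemma insert_commute norm_zero zero_neq_one scale_zero_left)
  have "d \<bullet> u = k" using assms(1) k by (simp add: norm_eq_1)
  thus ?thesis using k by simp
qed

text \<open>The minimum over the ball is \<open>p - n\<close>, attained at the unit vector opposite
  to \<open>(f, g, h)\<close>.\<close>

lemma linear_nonneg_on_ball:
  fixes p f g h :: real
  assumes "\<And>x y z. x\<^sup>2 + y\<^sup>2 + z\<^sup>2 \<le> 1 \<Longrightarrow> 0 \<le> p + x * f + y * g + z * h"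
  shows "0 \<le> p" "f\<^sup>2 + g\<^sup>2 + h\<^sup>2 \<le> p\<^sup>2"
proof -
  show p: "0 \<le> p" using assms[of 0 0 0] by simp
  define n where "n = sqrt (f\<^sup>2 + g\<^sup>2 + h\<^sup>2)"
  have n2: "n\<^sup>2 = f\<^sup>2 + g\<^sup>2 + h\<^sup>2" by (simp add: n_def add_nonneg_nonneg)
  have "n \<le> p"
  proof (cases "n = 0")
    case False
    have "(- f / n)\<^sup>2 + (- g / n)\<^sup>2 + (- h / n)\<^sup>2 = 1"
      using False by (simp add: power_divide flip: add_divide_distrib n2)
    from assms[OF eq_refl[OF this]]
    have "0 \<le> p + (- f / n) * f + (- g / n) * g + (- h / n) * h" .
    also have "\<dots> = p - n\<^sup>2 / n" unfolding n2 by (simp add: power2_eq_square add_divide_distrib algebra_simps)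
    finally show ?thesis using False by (simp add: power2_eq_square)
  qed (use p in simp)
  moreover have "0 \<le> n" by (simp add: n_def add_nonneg_nonneg)
  ultimately show "f\<^sup>2 + g\<^sup>2 + h\<^sup>2 \<le> p\<^sup>2" unfolding n2[symmetric] by (simp add: power_mono)
qed

section \<open>Necessity of the inequality\<close>

text \<open>Cauchy-Schwarz is applied twice: within each index to the last two coordinates, where
  the cone conditions split the bound into two nonnegative light-cone factors, and then over the
  indices to the square roots of these factors.\<close>

lemma witness_inequality:
  fixes X Y Z p f g h :: "'a \<Rightarrow> real"
  assumes "\<And>v. v \<in> C \<Longrightarrow> (X v)\<^sup>2 + (Y v)\<^sup>2 + (Z v)\<^sup>2 \<le> R\<^sup>2" "R > 0"
    and "\<And>v. v \<in> C \<Longrightarrow> 0 \<le> p v" "\<And>v. v \<in> C \<Longrightarrow> (f v)\<^sup>2 + (g v)\<^sup>2 + (h v)\<^sup>2 \<le> (p v)\<^sup>2"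
    and "0 \<le> (\<Sum>v\<in>C. Y v * g v + Z v * h v)"
  shows "(\<Sum>v\<in>C. Y v * g v + Z v * h v)\<^sup>2 \<le>
    (\<Sum>v\<in>C. (R + X v) * (p v - f v)) * (\<Sum>v\<in>C. (R - X v) * (p v + f v))"
proof -
  have pos: "0 \<le> (R + X v) * (p v - f v)" "0 \<le> (R - X v) * (p v + f v)" if "v \<in> C" for v
  proof -
    have "(X v)\<^sup>2 \<le> R\<^sup>2" "(f v)\<^sup>2 \<le> (p v)\<^sup>2"
      using assms(1,4)[OF that] by (smt (verit) zero_le_power2)+
    hence "\<bar>X v\<bar> \<le> R" "\<bar>f v\<bar> \<le> p v"
      using assms(2) assms(3)[OF that] by (simp_all flip: abs_le_square_iff)
    thus "0 \<le> (R + X v) * (p v - f v)" "0 \<le> (R - X v) * (p v + f v)" by auto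
  qed
  have "Y v * g v + Z v * h v \<le> sqrt ((R + X v) * (p v - f v)) * sqrt ((R - X v) * (p v + f v))" if "v \<in> C" for v
  proof -
    have "(Y v * g v + Z v * h v)\<^sup>2 \<le> ((Y v)\<^sup>2 + (Z v)\<^sup>2) * ((g v)\<^sup>2 + (h v)\<^sup>2)"
    proof -
      \<comment> \<open>Lagrange's identity.\<close>
      have "((Y v)\<^sup>2 + (Z v)\<^sup>2) * ((g v)\<^sup>2 + (h v)\<^sup>2) - (Y v * g v + Z v * h v)\<^sup>2 = (Y v * h v - Z v * g v)\<^sup>2"
        by algebra
      thus ?thesis by (smt (verit) zero_le_power2)
    qed
    also have "\<dots> \<le> (R\<^sup>2 - (X v)\<^sup>2) * ((p v)\<^sup>2 - (f v)\<^sup>2)"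
      using assms(1,4)[OF that] by (intro mult_mono) (auto intro: order_trans[OF _ assms(1)[OF that]] simp: algebra_simps)
    also have "\<dots> = ((R + X v) * (p v - f v)) * ((R - X v) * (p v + f v))" by algebra
    finally show ?thesis unfolding real_sqrt_mult[symmetric] by (rule real_le_rsqrt)
  qed
  hence "(\<Sum>v\<in>C. Y v * g v + Z v * h v) \<le> (\<Sum>v\<in>C. sqrt ((R + X v) * (p v - f v)) * sqrt ((R - X v) * (p v + f v)))"
    by (rule sum_mono)
  hence "(\<Sum>v\<in>C. Y v * g v + Z v * h v)\<^sup>2 \<le> (\<Sum>v\<in>C. sqrt ((R + X v) * (p v - f v)) * sqrt ((R - X v) * (p v + f v)))\<^sup>2"
    using assms(5) by (rule power_mono)
  also have "\<dots> \<le> (\<Sum>v\<in>C. (sqrt ((R + X v) * (p v - f v)))\<^sup>2) * (\<Sum>v\<in>C. (sqrt ((R - X v) * (p v + f v)))\<^sup>2)"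
    by (rule Cauchy_Schwarz_ineq_sum)
  also have "\<dots> = (\<Sum>v\<in>C. (R + X v) * (p v - f v)) * (\<Sum>v\<in>C. (R - X v) * (p v + f v))"
    using pos by simp
  finally show ?thesis .
qed

lemma simplex_ellipsoid_inequality:
  fixes b c :: "real^3"
  assumes fr: "orthonormal_frame u1 u2 u3" and C: "\<not> affine_dependent C" and sph: "C \<subseteq> cball b R"
    and sub: "ellipsoid c u1 u2 u3 s1 s2 s3 \<subseteq> convex hull C" and c: "c = b + \<delta> *\<^sub>R u1"
    and nn: "R > 0" "s2 \<ge> 0" "s3 \<ge> 0"
  shows "\<delta>\<^sup>2 \<le> (R - s1)\<^sup>2 - (s2 + s3)\<^sup>2"
proof -
  have fin: "finite C" using C by (rule aff_independent_finite)
  define q where "q x y z = c + (s1 * x) *\<^sub>R u1 + (s2 * y) *\<^sub>R u2 + (s3 * z) *\<^sub>R u3" for x y z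
  have "\<exists>u. (\<forall>v\<in>C. 0 \<le> u v) \<and> sum u C = 1 \<and> (\<Sum>v\<in>C. u v *\<^sub>R v) = q x y z" if "x\<^sup>2 + y\<^sup>2 + z\<^sup>2 \<le> 1" for x y z
  proof -
    have "q x y z \<in> convex hull C" using sub that by (auto simp: ellipsoid_def q_def)
    thus ?thesis by (simp add: convex_hull_finite[OF fin])
  qed
  hence "\<forall>x y z. \<exists>u. x\<^sup>2 + y\<^sup>2 + z\<^sup>2 \<le> 1 \<longrightarrow> (\<forall>v\<in>C. 0 \<le> u v) \<and> sum u C = 1 \<and> (\<Sum>v\<in>C. u v *\<^sub>R v) = q x y z"
    by blast
  then obtain L where "\<forall>x y z. x\<^sup>2 + y\<^sup>2 + z\<^sup>2 \<le> 1 \<longrightarrow> (\<forall>v\<in>C. 0 \<le> L x y z v) \<and> sum (L x y z) C = 1 \<and> (\<Sum>v\<in>C. L x y z v *\<^sub>R v) = q x y z"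
    unfolding choice_iff by blast
  hence L: "\<And>x y z v. x\<^sup>2 + y\<^sup>2 + z\<^sup>2 \<le> 1 \<Longrightarrow> v \<in> C \<Longrightarrow> 0 \<le> L x y z v"
    "\<And>x y z. x\<^sup>2 + y\<^sup>2 + z\<^sup>2 \<le> 1 \<Longrightarrow> sum (L x y z) C = 1"
    "\<And>x y z. x\<^sup>2 + y\<^sup>2 + z\<^sup>2 \<le> 1 \<Longrightarrow> (\<Sum>v\<in>C. L x y z v *\<^sub>R v) = q x y z"
    by blast+
  \<comment> \<open>The values at the origin and at the three unit vectors fix the only candidate
    for an affine function of the parameter. Uniqueness of barycentric coordinates then gives
    \<open>bary\<close>, also when a degenerate ellipsoid has a non-injective
    parametrisation.\<close>
  define p f g h where "p = L 0 0 0" and "f v = L 1 0 0 v - p v" and "g v = L 0 1 0 v - p v" and "h v = L 0 0 1 v - p v" for v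
  note fgh = f_def g_def h_def
  have s: "sum p C = 1" "sum f C = 0" "sum g C = 0" "sum h C = 0"
    using L(2) by (simp_all add: p_def fgh sum_subtractf)
  have S: "(\<Sum>v\<in>C. p v *\<^sub>R v) = c" "(\<Sum>v\<in>C. f v *\<^sub>R v) = s1 *\<^sub>R u1" "(\<Sum>v\<in>C. g v *\<^sub>R v) = s2 *\<^sub>R u2" "(\<Sum>v\<in>C. h v *\<^sub>R v) = s3 *\<^sub>R u3"
    using L(3) by (simp_all add: p_def fgh sum_subtractf scaleR_diff_left q_def)
  have bary: "L x y z v = p v + x * f v + y * g v + z * h v" if "x\<^sup>2 + y\<^sup>2 + z\<^sup>2 \<le> 1" "v \<in> C" for x y z v
  proof (rule bary_unique[OF C fin _ _ that(2)])
    show "sum (L x y z) C = (\<Sum>v\<in>C. p v + x * f v + y * g v + z * h v)"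
      using that s L(2) by (simp add: sum.distrib flip: sum_distrib_left)
    show "(\<Sum>v\<in>C. L x y z v *\<^sub>R v) = (\<Sum>v\<in>C. (p v + x * f v + y * g v + z * h v) *\<^sub>R v)"
      using that S L(3) by (simp add: scaleR_add_left sum.distrib q_def mult.commute flip: scaleR_scaleR scaleR_sum_right)
  qed
  have pos: "0 \<le> p v" "(f v)\<^sup>2 + (g v)\<^sup>2 + (h v)\<^sup>2 \<le> (p v)\<^sup>2" if "v \<in> C" for v
    using linear_nonneg_on_ball[of "p v" "f v" "g v" "h v"] L(1)[OF _ that] bary[OF _ that] by auto
  define X Y Z where "X v = (v - b) \<bullet> u1" and "Y v = (v - b) \<bullet> u2" and "Z v = (v - b) \<bullet> u3" for v
  have XYZ: "(X v)\<^sup>2 + (Y v)\<^sup>2 + (Z v)\<^sup>2 \<le> R\<^sup>2" if "v \<in> C" for v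
  proof -
    have "norm (v - b) \<le> R" using sph that by (auto simp: dist_norm norm_minus_commute)
    hence "(norm (v - b))\<^sup>2 \<le> R\<^sup>2" by (simp add: power_mono)
    thus ?thesis using frame_bessel[OF fr, of "v - b"] by (simp add: X_def Y_def Z_def)
  qed
  have coord: "(\<Sum>v\<in>C. ((v - b) \<bullet> u) * w v) = ((\<Sum>v\<in>C. w v *\<^sub>R v) - sum w C *\<^sub>R b) \<bullet> u" for u w
    by (simp add: inner_diff_left inner_sum_left sum_subtractf sum_distrib_right algebra_simps)
  have M: "(\<Sum>v\<in>C. X v * p v) = \<delta>" "(\<Sum>v\<in>C. X v * f v) = s1" "(\<Sum>v\<in>C. Y v * g v) = s2" "(\<Sum>v\<in>C. Z v * h v) = s3"
    unfolding X_def Y_def Z_def coord s S using frame_inner[OF fr] by (simp_all add: c)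
  have "(s2 + s3)\<^sup>2 \<le> (\<Sum>v\<in>C. (R + X v) * (p v - f v)) * (\<Sum>v\<in>C. (R - X v) * (p v + f v))"
    using witness_inequality[of C X Y Z R p f g h] XYZ pos nn M by (simp add: sum.distrib)
  also have "(\<Sum>v\<in>C. (R + X v) * (p v - f v)) = R + \<delta> - s1"
    using M s by (simp add: algebra_simps sum.distrib sum_subtractf flip: sum_distrib_left)
  also have "(\<Sum>v\<in>C. (R - X v) * (p v + f v)) = R - \<delta> - s1"
    using M s by (simp add: algebra_simps sum.distrib sum_subtractf flip: sum_distrib_left)
  finally show ?thesis by (simp add: power2_eq_square algebra_simps)
qed

section \<open>From decompositions to circumscribed tetrahedra\<close>

lemma ellipsoid_memI:
  assumes "x\<^sup>2 + y\<^sup>2 + z\<^sup>2 \<le> 1"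
  shows "c + (s1 * x) *\<^sub>R u1 + (s2 * y) *\<^sub>R u2 + (s3 * z) *\<^sub>R u3 \<in> ellipsoid c u1 u2 u3 s1 s2 s3"
  using assms by (auto simp: ellipsoid_def)

text \<open>The functions \<open>L X Y Z i\<close> are the barycentric coordinates of the ellipsoid
  point with parameter \<open>(X, Y, Z)\<close>: nonnegativity on the ball gives containment, and a
  zero of the \<open>j\<close>-th one gives contact with the face opposite
  \<open>v j\<close>.\<close>

lemma tangent_data_tetrahedron:
  fixes b :: "real^3"
  assumes fr: "orthonormal_frame u1 u2 u3" and R: "R > 0"
    and D: "tangent_data \<delta> s1 s2 s3 x y z p f g h"
  defines "E \<equiv> ellipsoid (b + (R * \<delta>) *\<^sub>R u1) u1 u2 u3 (R * s1) (R * s2) (R * s3)"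
  shows "\<exists>T. tetrahedron T \<and> inscribed_in T (sphere b R) \<and> E \<subseteq> T \<and> (\<forall>F. F facet_of T \<longrightarrow> F \<inter> E \<noteq> {})"
proof -
  note D' = D[unfolded tangent_data_def]
  have comb: "C * (\<Sum>i<4. w i * p i) + X * (\<Sum>i<4. w i * f i) + Y * (\<Sum>i<4. w i * g i) + Z * (\<Sum>i<4. w i * h i)
      = (\<Sum>i<4. w i * (C * p i + X * f i + Y * g i + Z * h i))" for w C X Y Z
    by (simp add: sum.distrib sum_distrib_left algebra_simps)
  define d where "d i = x i *\<^sub>R u1 + y i *\<^sub>R u2 + z i *\<^sub>R u3" for i
  define v where "v i = b + R *\<^sub>R d i" for i
  have sum_v: "(\<Sum>i<4. \<mu> i *\<^sub>R v i) = (\<Sum>i<4. \<mu> i) *\<^sub>R b + (R * (\<Sum>i<4. x i * \<mu> i)) *\<^sub>R u1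
      + (R * (\<Sum>i<4. y i * \<mu> i)) *\<^sub>R u2 + (R * (\<Sum>i<4. z i * \<mu> i)) *\<^sub>R u3" for \<mu>
    by (simp add: v_def d_def scaleR_sum_left sum.distrib sum_distrib_left scaleR_add_right algebra_simps)
  have indep: "\<mu> i = 0" if "(\<Sum>i<4. \<mu> i) = 0" "(\<Sum>i<4. \<mu> i *\<^sub>R v i) = 0" "i < 4" for \<mu> i
  proof -
    define X Y Z where "X = (\<Sum>i<4. x i * \<mu> i)" and "Y = (\<Sum>i<4. y i * \<mu> i)" and "Z = (\<Sum>i<4. z i * \<mu> i)"
    have "(R * X) *\<^sub>R u1 + (R * Y) *\<^sub>R u2 + (R * Z) *\<^sub>R u3 = 0"
      using that(2) unfolding sum_v that(1) X_def Y_def Z_def by simp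
    hence "(R * X)\<^sup>2 + (R * Y)\<^sup>2 + (R * Z)\<^sup>2 = 0" using frame_norm[OF fr, of "R * X" "R * Y" "R * Z"] by simp
    hence "X = 0" "Y = 0" "Z = 0" using R by (simp_all add: add_nonneg_eq_0_iff)
    thus ?thesis using D' that unfolding X_def Y_def Z_def by blast
  qed
  have inj: "inj_on v {..<4}"
  proof (rule inj_onI, rule ccontr)
    fix i j :: nat assume ij: "i \<in> {..<4}" "j \<in> {..<4}" "v i = v j" "i \<noteq> j"
    \<comment> \<open>Two coinciding vertices would give this nontrivial affine relation.\<close>
    define \<mu> :: "nat \<Rightarrow> real" where "\<mu> k = (if k = i then 1 else 0) - (if k = j then 1 else 0)" for k
    have "(\<Sum>k<4. \<mu> k) = 0" using ij by (simp add: \<mu>_def sum_subtractf)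
    moreover have "(\<Sum>k<4. \<mu> k *\<^sub>R v k) = (\<Sum>k<4. (if k = i then v k else 0) - (if k = j then v k else 0))"
      by (intro sum.cong) (auto simp: \<mu>_def)
    hence "(\<Sum>k<4. \<mu> k *\<^sub>R v k) = 0" using ij by (simp add: sum_subtractf)
    ultimately have "\<mu> i = 0" using indep ij by blast
    thus False using ij by (simp add: \<mu>_def)
  qed
  define V where "V = v ` {..<4}"
  have aff: "\<not> affine_dependent V"
  proof
    assume "affine_dependent V"
    then obtain U w where U: "sum U V = 0" "w \<in> V" "U w \<noteq> 0" "(\<Sum>w\<in>V. U w *\<^sub>R w) = 0"
      using affine_dependent_explicit_finite[of V] by (auto simp: V_def)
    have "(\<Sum>i<4. U (v i)) = 0" "(\<Sum>i<4. U (v i) *\<^sub>R v i) = 0"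
      using U inj by (simp_all add: V_def sum.reindex)
    hence "\<forall>i<4. U (v i) = 0" using indep[of "\<lambda>i. U (v i)"] by blast
    thus False using U by (auto simp: V_def)
  qed
  have tet: "tetrahedron (convex hull V)"
    unfolding tetrahedron_def simplex using aff inj by (intro exI[of _ V]) (simp add: V_def card_image)
  have ins: "inscribed_in (convex hull V) (sphere b R)"
    unfolding inscribed_in_def
  proof (intro allI impI)
    fix a assume "a extreme_point_of convex hull V"
    then obtain i where i: "i < 4" "a = v i" using extreme_point_of_convex_hull[of a V] by (auto simp: V_def)
    have "(norm (d i))\<^sup>2 = 1" using D' i frame_norm[OF fr] by (simp add: d_def)
    hence "norm (d i) = 1" by (simp add: power2_eq_1_iff) (smt (verit) norm_ge_zero)
    thus "a \<in> sphere b R" using i R by (simp add: v_def dist_norm)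
  qed
  define L where "L X Y Z i = 1 * p i + X * f i + Y * g i + Z * h i" for X Y Z i
  define q where "q X Y Z = b + (R * \<delta>) *\<^sub>R u1 + (R * s1 * X) *\<^sub>R u1 + (R * s2 * Y) *\<^sub>R u2 + (R * s3 * Z) *\<^sub>R u3" for X Y Z
  have L1: "(\<Sum>i<4. L X Y Z i) = 1" for X Y Z
    using comb[of 1 "\<lambda>_. 1" X Y Z] D' by (simp add: L_def)
  have Lq: "(\<Sum>i<4. L X Y Z i *\<^sub>R v i) = q X Y Z" for X Y Z
    unfolding sum_v L1 unfolding L_def comb[symmetric] q_def using D' by (simp add: algebra_simps)
  have Lpos: "0 \<le> L X Y Z i" if "X\<^sup>2 + Y\<^sup>2 + Z\<^sup>2 \<le> 1" "i < 4" for X Y Z i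
  proof -
    have pi: "0 \<le> p i" "(p i)\<^sup>2 = (f i)\<^sup>2 + (g i)\<^sup>2 + (h i)\<^sup>2" using D' that by auto
    \<comment> \<open>Lagrange's identity in three dimensions, which yields Cauchy-Schwarz.\<close>
    have "(X * f i + Y * g i + Z * h i)\<^sup>2 + (X * g i - Y * f i)\<^sup>2 + (X * h i - Z * f i)\<^sup>2 + (Y * h i - Z * g i)\<^sup>2
        = (X\<^sup>2 + Y\<^sup>2 + Z\<^sup>2) * (p i)\<^sup>2" unfolding pi by algebra
    also have "\<dots> \<le> 1 * (p i)\<^sup>2" using that by (intro mult_right_mono) auto
    finally have "(X * f i + Y * g i + Z * h i)\<^sup>2 \<le> (p i)\<^sup>2"
      using zero_le_power2[of "X * g i - Y * f i"] zero_le_power2[of "X * h i - Z * f i"] zero_le_power2[of "Y * h i - Z * g i"]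
      by linarith
    hence "\<bar>X * f i + Y * g i + Z * h i\<bar> \<le> \<bar>p i\<bar>" by (simp only: abs_le_square_iff)
    thus ?thesis using pi(1) by (simp add: L_def)
  qed
  have sub: "E \<subseteq> convex hull V"
  proof
    fix a assume "a \<in> E"
    then obtain X Y Z where a: "a = q X Y Z" "X\<^sup>2 + Y\<^sup>2 + Z\<^sup>2 \<le> 1"
      by (auto simp: E_def ellipsoid_def q_def)
    have "(\<Sum>i<4. L X Y Z i *\<^sub>R v i) \<in> convex hull V"
      using Lpos[OF a(2)] L1 by (intro convex_sum) (auto simp: V_def intro: hull_inc)
    thus "a \<in> convex hull V" by (simp add: Lq a)
  qed
  have "F \<inter> E \<noteq> {}" if F: "F facet_of convex hull V" for F
  proof -
    obtain j where j: "j < 4" "F = convex hull (V - {v j})"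
      using F facet_of_convex_hull_affine_independent[OF aff] by (auto simp: V_def)
    have pj: "(p j)\<^sup>2 = (f j)\<^sup>2 + (g j)\<^sup>2 + (h j)\<^sup>2" using D' j by auto
    \<comment> \<open>If \<open>p j = 0\<close> the coordinate vanishes identically and the centre
      serves; otherwise the minimiser on the unit sphere does.\<close>
    obtain X Y Z where X: "X\<^sup>2 + Y\<^sup>2 + Z\<^sup>2 \<le> 1" "L X Y Z j = 0"
    proof (cases "p j = 0")
      case True
      thus ?thesis using that[of 0 0 0] by (simp add: L_def)
    next
      case False
      have e: "(- f j / p j)\<^sup>2 + (- g j / p j)\<^sup>2 + (- h j / p j)\<^sup>2 = 1"
        using False by (simp add: power_divide flip: add_divide_distrib pj)
      have "L (- f j / p j) (- g j / p j) (- h j / p j) j = p j - ((f j)\<^sup>2 + (g j)\<^sup>2 + (h j)\<^sup>2) / p j"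
        by (simp add: L_def power2_eq_square add_divide_distrib algebra_simps)
      also have "\<dots> = 0" using False unfolding pj[symmetric] by (simp add: power2_eq_square)
      finally show ?thesis by (rule that[OF eq_refl[OF e]])
    qed
    have split: "sum G {..<4} = G j + sum G ({..<4} - {j})" for G :: "nat \<Rightarrow> 'b::comm_monoid_add"
      using j by (simp add: sum.remove)
    have "sum (L X Y Z) ({..<4} - {j}) = 1" "(\<Sum>i\<in>{..<4} - {j}. L X Y Z i *\<^sub>R v i) = q X Y Z"
      using L1[of X Y Z] Lq[of X Y Z] X(2) unfolding split by simp_all
    moreover have "v i \<in> convex hull (V - {v j})" if "i \<in> {..<4} - {j}" for i
      using that inj j by (intro hull_inc) (auto simp: V_def dest: inj_onD)
    ultimately have "q X Y Z \<in> convex hull (V - {v j})"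
      using convex_sum[of "{..<4} - {j}" "convex hull (V - {v j})" "L X Y Z" v] Lpos[OF X(1)] by simp
    moreover have "q X Y Z \<in> E" using X(1) by (auto simp: E_def ellipsoid_def q_def)
    ultimately show ?thesis using j by blast
  qed
  thus ?thesis using tet ins sub by blast
qed

section \<open>The equivalence for arbitrary radius\<close>

theorem corollary4:
  fixes b c d u1 u2 u3 :: "real^3"
    and R s1 s2 s3 :: real
    and E :: "(real^3) set"
  assumes "R > 0"
    and "s1 \<ge> 0" "s2 \<ge> 0" "s3 \<ge> 0"
    and "orthonormal_frame u1 u2 u3"
    and "E = ellipsoid c u1 u2 u3 s1 s2 s3"
    and "E \<subseteq> cball b R"
    and "d = c - b"
    and "collinear {0, d, u1}"
  shows "(\<exists>T. tetrahedron T \<and> circumscribed_about T E \<and> inscribed_in T (sphere b R))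
         \<longleftrightarrow> (norm d)\<^sup>2 \<le> (R - s1)\<^sup>2 - (s2 + s3)\<^sup>2"
proof -
  note fr = assms(5)
  have u1: "norm u1 = 1" using fr by (simp add: orthonormal_frame_def)
  define \<delta> where "\<delta> = d \<bullet> u1"
  have d: "d = \<delta> *\<^sub>R u1" unfolding \<delta>_def using u1 assms(9) by (rule frame_collinear)
  have c: "c = b + \<delta> *\<^sub>R u1" using assms(8) d by (simp add: algebra_simps)
  have nd: "(norm d)\<^sup>2 = \<delta>\<^sup>2" using d u1 by simp
  have ball: "\<bar>\<delta>\<bar> + s1 \<le> R"
  proof -
    have "c + (s1 * t) *\<^sub>R u1 + (s2 * 0) *\<^sub>R u2 + (s3 * 0) *\<^sub>R u3 \<in> E" if "t\<^sup>2 \<le> 1" for t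
      unfolding assms(6) using that by (intro ellipsoid_memI) simp
    hence "b + (\<delta> + s1 * t) *\<^sub>R u1 \<in> cball b R" if "t\<^sup>2 \<le> 1" for t
      using subsetD[OF assms(7)] that by (simp add: c scaleR_add_left add.assoc)
    hence "\<bar>\<delta> + s1 * t\<bar> \<le> R" if "t\<^sup>2 \<le> 1" for t using that u1 by (simp add: dist_norm)
    \<comment> \<open>The two ends of the \<open>s1\<close> axis.\<close>
    from this[of 1] this[of "-1"] show ?thesis by auto
  qed
  show ?thesis
  proof
    assume "\<exists>T. tetrahedron T \<and> circumscribed_about T E \<and> inscribed_in T (sphere b R)"
    then obtain T C where T: "\<not> affine_dependent C" "T = convex hull C" "E \<subseteq> T" "inscribed_in T (sphere b R)"
      unfolding tetrahedron_def simplex circumscribed_about_def by blast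
    have "C \<subseteq> cball b R"
      using T by (auto simp: inscribed_in_def extreme_point_of_convex_hull_affine_independent)
    thus "(norm d)\<^sup>2 \<le> (R - s1)\<^sup>2 - (s2 + s3)\<^sup>2"
      unfolding nd using simplex_ellipsoid_inequality[OF fr T(1)] T c assms by blast
  next
    assume cond: "(norm d)\<^sup>2 \<le> (R - s1)\<^sup>2 - (s2 + s3)\<^sup>2"
    show "\<exists>T. tetrahedron T \<and> circumscribed_about T E \<and> inscribed_in T (sphere b R)"
    proof (cases "s1 + s2 + s3 = 0")
      case True
      hence s: "s1 = 0" "s2 = 0" "s3 = 0" using assms(2-4) by auto
      have E: "E = {c}" by (auto simp: assms(6) ellipsoid_def s intro!: exI[of _ 0])
      \<comment> \<open>For a one-point ellipsoid it suffices to take an inscribed tetrahedron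
        containing the whole diameter along \<open>u1\<close>, since \<open>c\<close> lies on that
        diameter.\<close>
      obtain x y z p f g h where "tangent_data 0 1 0 0 x y z p f g h"
        using tangent_data_segment[of 0 1] by auto
      from tangent_data_tetrahedron[OF fr assms(1) this, of b] obtain T where T: "tetrahedron T"
          "inscribed_in T (sphere b R)" "ellipsoid b u1 u2 u3 R 0 0 \<subseteq> T"
        by auto
      have "(\<delta> / R)\<^sup>2 \<le> 1" using ball s assms(1) by (simp add: abs_square_le_1)
      hence "b + (R * (\<delta> / R)) *\<^sub>R u1 + (0 * 0) *\<^sub>R u2 + (0 * 0) *\<^sub>R u3 \<in> ellipsoid b u1 u2 u3 R 0 0"
        by (intro ellipsoid_memI) simp
      hence "c \<in> T" using T assms(1) by (auto simp: c)
      thus ?thesis using T E by (auto simp: circumscribed_about_def)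
    next
      case False
      \<comment> \<open>Rescaling to the unit sphere.\<close>
      define \<delta>' a1 a2 a3 where "\<delta>' = \<delta> / R" and "a1 = s1 / R" and "a2 = s2 / R" and "a3 = s3 / R"
      have sc: "\<delta> = R * \<delta>'" "s1 = R * a1" "s2 = R * a2" "s3 = R * a3"
        using assms(1) by (simp_all add: \<delta>'_def a1_def a2_def a3_def)
      have a: "a1 \<ge> 0" "a2 \<ge> 0" "a3 \<ge> 0" "a1 \<le> 1" using assms ball by (simp_all add: a1_def a2_def a3_def)
      have "R * (a1 + a2 + a3) \<noteq> 0" using False unfolding sc by (simp add: distrib_left)
      hence "a1 + a2 + a3 > 0" using a by (simp add: less_le)
      moreover have "R\<^sup>2 * \<delta>'\<^sup>2 \<le> R\<^sup>2 * ((1 - a1)\<^sup>2 - (a2 + a3)\<^sup>2)"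
        using cond unfolding nd unfolding sc by (simp add: power2_eq_square algebra_simps)
      hence "\<delta>'\<^sup>2 \<le> (1 - a1)\<^sup>2 - (a2 + a3)\<^sup>2" using assms(1) by simp
      ultimately obtain x y z p f g h where "tangent_data \<delta>' a1 a2 a3 x y z p f g h"
        using tangent_data_exists[of a1 a2 a3 \<delta>'] a by blast
      from tangent_data_tetrahedron[OF fr assms(1) this, of b] show ?thesis
        unfolding circumscribed_about_def assms(6) c sc by blast
    qed
  qed
qed

end
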